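(* Assume that $\lim_{x\to\infty}x^p(\xi(\infty)-\xi(x))=0$ almost surely. Let $W'_\infty(t):=t-\sup\{s\le t:W_\infty(s)=0\}$ for $t\ge0$. Then for every $t\ge0$, as $a\to\infty$, $$\frac{a^p}{\lambda}\,\langle\chi\mathbf 1_{[a,\infty)},\widetilde{\mathcal Z}(t)\rangle\to W'_\infty(t)\quad\text{almost surely},$$ $$\frac{(p+1)a^{p+1}}{p\lambda}\,\widetilde{\mathcal Z}(t)[a,\infty)\to W'_\infty(t)\quad\text{almost surely},$$ where $\chi(x)=x$. In particular, for any $t\ge0$, almost surely on the event $\{W'_\infty(t)\ne0\}$, as $a\to\infty$, $$\frac{\langle\chi\mathbf 1_{[a,\infty)},\widetilde{\mathcal Z}(t)\rangle}{\mathbb E(v\mid v\ge a)\,\widetilde{\mathcal Z}(t)[a,\infty)}\to1.$$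
   Context: Notation: $\langle f,\mu\rangle=\int f\,d\mu$; $\mathbb R_+=[0,\infty)$; the Skorohod map is $\Gamma[f](t)=f(t)-\inf_{0\le s\le t}(f(s)\wedge 0)$; the supremum in the definition of $W'_\infty(t)$ is taken to be $0$ if the set is empty. Fix $p>1$. $v$ is a strictly positive random variable with continuous distribution function $F$, $F(0)=0$, and $\overline F=1-F$ satisfies $\overline F(t)>0$ and $\lim_{x\to\infty}\overline F(tx)/\overline F(x)=t^{-(p+1)}$ for all $t>0$ (so $v$ has finite second moment). Constants: $\lambda=1/\mathbb E(v)$, $\sigma_A\in(0,\infty)$, $\kappa\in\mathbb R$, and $\sigma>0$ with $\sigma^2=\lambda\operatorname{Var}(v)+\lambda\sigma_A^2$. $(\xi(a))_{a\in\mathbb R_+}$ is an $\mathbb R_+$-valued continuous nondecreasing process with $\xi(0)=0$, $\xi(\infty):=\lim_{a\to\infty}\xi(a)$, $\mathbb E(\xi(\infty))<\infty$, and there are $\eta^*\in(0,p-1)$ and $\alpha^*\in(0,p]$ with $\sup_{a>0}a^{-(p-\eta^* )}\mathbb E(\xi(a))<\infty$ and $\limsup_{a\to\infty}a^{\alpha^*}\mathbb E(\xi(\infty)-\xi(a))<\infty$. $B$ is a standard Brownian motion independent of $\xi$. Put $X_0(t)=0$, $X_a(t)=\xi(a)+\sigma B(t)+(\kappa-\lambda a^{-p})t$ for $0<a<\infty$, $X_\infty(t)=\xi(\infty)+\sigma B(t)+\kappa t$, and $W_a=\Gamma[X_a]$ for $a\in[0,\infty]$. $\widetilde{\mathcal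 Z}(\cdot)$ is the process with values in the finite nonnegative Borel measures on $\mathbb R_+$ characterized by: for each $t\ge0$, $\widetilde{\mathcal Z}(t)(\{0\})=0$, $\widetilde{\mathcal Z}(t)(\mathbb R_+)=\int_0^\infty x^{-2}W_x(t)\,dx$, and $\widetilde{\mathcal Z}(t)[a,b]=\int_a^bx^{-2}W_x(t)\,dx+\frac{W_b(t)}b-\frac{W_a(t)}a$ for $0<a<b<\infty$. (It is the distributional limit, under heavy traffic, of rescaled measures describing the remaining processing times in a sequence of single-server shortest-remaining-processing-time queues with processing times distributed as $v$; $\xi$ is the limiting initial truncated workload, $\lambda$ and $\sigma_A$ the limiting arrival rate and standard deviation of interarrival times, and $\kappa$ the heavy-traffic parameter. The statement concerns only the limit objects.) *)

theory Defs
  imports "HOL-Probability.Probability"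
begin

definition skorohod_map :: "(real \<Rightarrow> real) \<Rightarrow> real \<Rightarrow> real" where
  "skorohod_map f t = f t - (INF s\<in>{0..t}. min (f s) 0)"

definition standard_brownian_motion :: "'a measure \<Rightarrow> (real \<Rightarrow> 'a \<Rightarrow> real) \<Rightarrow> bool" where
  "standard_brownian_motion M B \<longleftrightarrow>
     (\<forall>t\<ge>0. B t \<in> borel_measurable M) \<and>
     (AE \<omega> in M. B 0 \<omega> = 0) \<and>
     (AE \<omega> in M. continuous_on {0..} (\<lambda>t. B t \<omega>)) \<and>
     (\<forall>s t. 0 \<le> s \<and> s < t \<longrightarrow>
        distributed M lborel (\<lambda>\<omega>. B t \<omega> - B s \<omega>) (normal_density 0 (sqrt (t - s)))) \<and>
     (\<forall>(n::nat) \<tau> :: nat \<Rightarrow> real. 0 \<le> \<tau> 0 \<and> (\<forall>i<n. \<tau> i \<le> \<tau> (Suc i)) \<longrightarrow>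
        prob_space.indep_vars M (\<lambda>_. borel) (\<lambda>i \<omega>. B (\<tau> (Suc i)) \<omega> - B (\<tau> i) \<omega>) {..<n})"

text \<open>Independence as random elements of the path space, with the product sigma-algebra,
  i.e. independence of the sigma-algebras generated by the two processes.\<close>

definition indep_processes ::
    "'a measure \<Rightarrow> (real \<Rightarrow> 'a \<Rightarrow> real) \<Rightarrow> (real \<Rightarrow> 'a \<Rightarrow> real) \<Rightarrow> bool" where
  "indep_processes M Y Z \<longleftrightarrow>
     prob_space.indep_var M
       (Pi\<^sub>M {0..} (\<lambda>_. borel)) (\<lambda>\<omega>. \<lambda>t\<in>{0..}. Y t \<omega>)
       (Pi\<^sub>M {0..} (\<lambda>_. borel)) (\<lambda>\<omega>. \<lambda>t\<in>{0..}. Z t \<omega>)"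

text \<open>The following operate on a single sample path \<open>x\<close> of \<open>\<xi>\<close> and \<open>b\<close> of the
  Brownian motion.  \<open>value_at_infinity x\<close> is an unspecified real number if \<open>x\<close> has no finite
  limit; convergence is always assumed alongside.\<close>

definition value_at_infinity :: "(real \<Rightarrow> real) \<Rightarrow> real" where
  "value_at_infinity x = Lim at_top x"

definition X_path ::
    "real \<Rightarrow> real \<Rightarrow> real \<Rightarrow> real \<Rightarrow> (real \<Rightarrow> real) \<Rightarrow> (real \<Rightarrow> real) \<Rightarrow> real \<Rightarrow> real \<Rightarrow> real" where
  "X_path p lam \<sigma> \<kappa> x b a t =
     (if a = 0 then 0 else x a + \<sigma> * b t + (\<kappa> - lam * a powr (- p)) * t)"

definition X_infinity_path ::
    "real \<Rightarrow> real \<Rightarrow> (real \<Rightarrow> real) \<Rightarrow> (real \<Rightarrow> real) \<Rightarrow> real \<Rightarrow> real" where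
  "X_infinity_path \<sigma> \<kappa> x b t = value_at_infinity x + \<sigma> * b t + \<kappa> * t"

definition W_path ::
    "real \<Rightarrow> real \<Rightarrow> real \<Rightarrow> real \<Rightarrow> (real \<Rightarrow> real) \<Rightarrow> (real \<Rightarrow> real) \<Rightarrow> real \<Rightarrow> real \<Rightarrow> real" where
  "W_path p lam \<sigma> \<kappa> x b a = skorohod_map (X_path p lam \<sigma> \<kappa> x b a)"

definition W_infinity_path ::
    "real \<Rightarrow> real \<Rightarrow> (real \<Rightarrow> real) \<Rightarrow> (real \<Rightarrow> real) \<Rightarrow> real \<Rightarrow> real" where
  "W_infinity_path \<sigma> \<kappa> x b = skorohod_map (X_infinity_path \<sigma> \<kappa> x b)"

definition time_since_zero :: "(real \<Rightarrow> real) \<Rightarrow> real \<Rightarrow> real" where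
  "time_since_zero w t =
     t - (if {s \<in> {0..t}. w s = 0} = {} then 0 else Sup {s \<in> {0..t}. w s = 0})"

text \<open>\<open>mu\<close> is the finite Borel measure on the half line determined by \<open>w\<close>, where \<open>w x\<close> stands for
  \<open>W\<^sub>x(t)\<close> at a fixed time and sample point.  The total mass is an extended nonnegative integral,
  so that its finiteness is part of the condition.\<close>

definition is_limit_measure :: "(real \<Rightarrow> real) \<Rightarrow> real measure \<Rightarrow> bool" where
  "is_limit_measure w mu \<longleftrightarrow>
     sets mu = sets (restrict_space borel {0..}) \<and>
     finite_measure mu \<and>
     measure mu {0} = 0 \<and>
     emeasure mu {0..} = (\<integral>\<^sup>+x\<in>{0<..}. ennreal (w x / x\<^sup>2) \<partial>lborel) \<and>
     (\<forall>a b. 0 < a \<and> a < b \<longrightarrow>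
        measure mu {a..b} = (LBINT x:{a..b}. w x / x\<^sup>2) + w b / b - w a / a)"

text \<open>The elementary conditional expectation of \<open>v\<close> given the event \<open>v \<ge> a\<close>.\<close>

definition cond_exp_ge :: "'b measure \<Rightarrow> ('b \<Rightarrow> real) \<Rightarrow> real \<Rightarrow> real" where
  "cond_exp_ge N v a =
     (\<integral>\<omega>. v \<omega> * indicator {\<omega> \<in> space N. a \<le> v \<omega>} \<omega> \<partial>N) / measure N {\<omega> \<in> space N. a \<le> v \<omega>}"

end

theory Submission
  imports Defs
begin

text \<open>Fix \<open>t\<close> and a sample path, and put \<open>R(a) = W\<^sub>\<infinity>(t) - W\<^sub>a(t)\<close>. The path \<open>X\<^sub>a\<close> is \<open>X\<^sub>\<infinity>\<close> minus
  \<open>\<delta> s + o(\<delta>)\<close> with \<open>\<delta> = \<lambda> a\<^sup>-\<^sup>p\<close>, and the one-sided derivative of the Skorohod map in this direction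
  is \<open>t\<close> minus the last minimizer of the path, i.e. the last zero of \<open>W\<^sub>\<infinity>\<close> before \<open>t\<close> (or \<open>0\<close>); hence
  \<open>a\<^sup>p R(a) \<rightarrow> \<lambda> W'\<^sub>\<infinity>(t)\<close>. Letting \<open>b \<rightarrow> \<infinity>\<close> in the formula for the mass of \<open>[a,b]\<close> gives the
  mass of \<open>[a,\<infinity>)\<close> as \<open>R(a)/a\<close> minus the integral of \<open>R(x)/x\<^sup>2\<close> over \<open>[a,\<infinity>)\<close>, and the truncated first
  moment is \<open>a\<close> times this mass plus its integral over \<open>[a,\<infinity>)\<close>, so both limits follow by
  integrating power asymptotics. The same layer-cake formula applied to \<open>v\<close>, with Karamata's
  theorem, shows that the conditional mean of \<open>v\<close> given \<open>v \<ge> a\<close> is asymptotically \<open>a (p+1)/p\<close>.\<close>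

section \<open>The Skorohod map: comparison and one-sided derivative\<close>

text \<open>Subtracting the infimum of \<open>min (f s) 0\<close> amounts to taking the larger of
  \<open>f t\<close> and the supremum of all \<open>f t - f s\<close>, so upper bounds can be
  checked competitor by competitor. Continuity keeps the infimum bounded below, without which
  \<open>INF\<close> has no useful value.\<close>

lemma skorohod_map_le_iff:
  assumes "0 \<le> t" "continuous_on {0..t} f"
  shows "skorohod_map f t \<le> c \<longleftrightarrow> f t \<le> c \<and> (\<forall>s\<in>{0..t}. f t - f s \<le> c)"
proof -
  have "continuous_on {0..t} (\<lambda>s. min (f s) 0)"
    using assms(2) by (intro continuous_intros)
  then have "compact ((\<lambda>s. min (f s) 0) ` {0..t})"
    by (intro compact_continuous_image) auto
  then have bdd: "bdd_below ((\<lambda>s. min (f s) 0) ` {0..t})"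
    by (intro bounded_imp_bdd_below compact_imp_bounded)
  have "skorohod_map f t \<le> c \<longleftrightarrow> f t - c \<le> (INF s\<in>{0..t}. min (f s) 0)"
    by (auto simp: skorohod_map_def)
  also have "\<dots> \<longleftrightarrow> (\<forall>s\<in>{0..t}. f t - c \<le> min (f s) 0)"
    using assms(1) bdd by (intro le_cINF_iff) auto
  also have "\<dots> \<longleftrightarrow> f t \<le> c \<and> (\<forall>s\<in>{0..t}. f t - f s \<le> c)"
    using assms(1) by (fastforce simp: min_def split: if_splits)
  finally show ?thesis .
qed

lemma skorohod_map_ge:
  assumes "0 \<le> t" "continuous_on {0..t} f"
  shows "f t \<le> skorohod_map f t" "\<And>s. s \<in> {0..t} \<Longrightarrow> f t - f s \<le> skorohod_map f t"
    "0 \<le> skorohod_map f t"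
proof -
  show "f t - f s \<le> skorohod_map f t" if "s \<in> {0..t}" for s
    using skorohod_map_le_iff[OF assms, of "skorohod_map f t"] that assms(1) by auto
  show "f t \<le> skorohod_map f t"
    using skorohod_map_le_iff[OF assms, of "skorohod_map f t"] by auto
  show "0 \<le> skorohod_map f t"
    using skorohod_map_le_iff[OF assms, of "skorohod_map f t"] assms(1)
    by (metis atLeastAtMost_iff diff_self order_refl)
qed

lemma skorohod_map_eq_0_iff:
  assumes "0 \<le> t" "continuous_on {0..t} f"
  shows "skorohod_map f t = 0 \<longleftrightarrow> f t \<le> 0 \<and> (\<forall>s\<in>{0..t}. f t \<le> f s)"
  using skorohod_map_le_iff[OF assms, of 0] skorohod_map_ge(3)[OF assms] by auto

text \<open>The last hypothesis bounds each competitor \<open>f t - f s\<close> by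
  \<open>g t - g s\<close>. It holds when \<open>g - f\<close> is nondecreasing, which is how
  workload paths with different thresholds compare.\<close>

lemma skorohod_map_mono:
  assumes "0 \<le> t" "continuous_on {0..t} f" "continuous_on {0..t} g"
    and "f t \<le> g t" "\<And>s. s \<in> {0..t} \<Longrightarrow> g s - f s \<le> g t - f t"
  shows "skorohod_map f t \<le> skorohod_map g t"
  using skorohod_map_ge[OF assms(1,3)] assms(4,5)
  by (subst skorohod_map_le_iff[OF assms(1,2)]) (smt (verit))

text \<open>An envelope argument: the perturbation lowers the competitor \<open>f t - f s\<close> by
  \<open>\<delta> x * (t - s)\<close>, so among the maximizers the last one loses least and fixes
  the derivative. The competitor \<open>f t\<close> loses
  \<open>\<epsilon> x + \<delta> x * t\<close>, to first order the loss at \<open>s = 0\<close>;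
  this accounts for the value 0 when there is no zero.\<close>

lemma tendsto_skorohod_map_perturbation:
  fixes f :: "real \<Rightarrow> real"
  assumes t: "0 \<le> t" and f: "continuous_on {0..t} f"
    and \<delta>: "(\<delta> \<longlongrightarrow> 0) F" "\<forall>\<^sub>F x in F. \<delta> x > 0"
    and \<epsilon>: "\<forall>\<^sub>F x in F. \<epsilon> x \<ge> 0" "((\<lambda>x. \<epsilon> x / \<delta> x) \<longlongrightarrow> 0) F"
  shows "((\<lambda>x. (skorohod_map f t - skorohod_map (\<lambda>s. f s - \<epsilon> x - \<delta> x * s) t) / \<delta> x)
           \<longlongrightarrow> time_since_zero (skorohod_map f) t) F"
proof -
  \<comment> \<open>Every \<open>s\<close> with \<open>f t - f s = w\<close> lies in \<open>S\<close>, so no \<open>s\<close> right of \<open>u + h\<close> competes for the perturbed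
    supremum; conversely such \<open>s\<close> exist arbitrarily close to \<open>u\<close> if \<open>S\<close> is nonempty.\<close>
  define S where "S = {s \<in> {0..t}. skorohod_map f s = 0}"
  define u where "u = (if S = {} then 0 else Sup S)"
  define w where "w = skorohod_map f t"
  have f': "continuous_on {0..s} f" if "s \<le> t" for s
    using continuous_on_subset[OF f] that by auto
  have S_iff: "s \<in> S \<longleftrightarrow> s \<in> {0..t} \<and> f s \<le> 0 \<and> (\<forall>r\<in>{0..s}. f s \<le> f r)" for s
    using skorohod_map_eq_0_iff[OF _ f', of s] by (auto simp: S_def)
  have bdd: "bdd_above S" by (auto simp: S_def)
  have S_le: "s \<le> u" if "s \<in> S" for s
    using that cSup_upper[OF that bdd] by (auto simp: u_def)
  have u0: "0 \<le> u"
  proof (cases "S = {}")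
    case False
    then obtain s where "s \<in> S" by auto
    then show ?thesis using S_le[of s] by (auto simp: S_def)
  qed (simp add: u_def)
  have limit: "time_since_zero (skorohod_map f) t = t - u"
    unfolding time_since_zero_def u_def S_def ..
  have g: "continuous_on {0..t} (\<lambda>s. f s - \<epsilon> x - \<delta> x * s)" for x
    using f by (intro continuous_intros)
  note w_ge = skorohod_map_ge[OF t f, folded w_def]
  have hit: "s \<in> S" if "s \<in> {0..t}" "f t - f s = w" for s
    unfolding S_iff using w_ge that by (smt (verit) atLeastAtMost_iff)
  show ?thesis
  proof (rule tendstoI)
    fix e :: real assume e: "e > 0"
    define h where "h = e / 4"
    have h: "h > 0" using e by (simp add: h_def)
    \<comment> \<open>Beyond \<open>u\<close> the value \<open>w\<close> is not attained, so
      compactness of \<open>{u + h..t}\<close> gives a uniform gap \<open>c\<close>.\<close>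
    obtain c where c: "c > 0" "\<And>s. s \<in> {u + h..t} \<Longrightarrow> f t - f s \<le> w - c"
    proof (cases "{u + h..t} = {}")
      case True
      then show ?thesis using that[of 1] by auto
    next
      case False
      have "continuous_on {u + h..t} f"
        using continuous_on_subset[OF f] u0 h by auto
      then obtain s where s: "s \<in> {u + h..t}" "\<And>r. r \<in> {u + h..t} \<Longrightarrow> f s \<le> f r"
        using continuous_attains_inf[of "{u + h..t}" f] False by auto
      have "f t - f s \<noteq> w"
        using hit[of s] S_le[of s] s(1) u0 h by auto
      moreover have "f t - f s \<le> w"
        using w_ge(2)[of s] s(1) u0 h by auto
      ultimately show ?thesis
        using that[of "w - (f t - f s)"] s(2) by fastforce
    qed
    \<comment> \<open>Competitors up to \<open>u + h\<close> lose at least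
      \<open>\<delta> x * (t - u - h)\<close>; the later ones start below \<open>w\<close> by
      \<open>c\<close>, which exceeds that loss once \<open>\<delta> x\<close> is small.\<close>
    have lower: "skorohod_map (\<lambda>s. f s - \<epsilon> x - \<delta> x * s) t \<le> w - \<delta> x * (t - u - h)"
      if "\<epsilon> x \<ge> 0" "\<delta> x > 0" "\<delta> x * (t + 1) \<le> c" for x
    proof (subst skorohod_map_le_iff[OF t g], intro conjI ballI)
      have "0 \<le> \<delta> x * (u + h)" using that u0 h by simp
      then show "f t - \<epsilon> x - \<delta> x * t \<le> w - \<delta> x * (t - u - h)"
        using w_ge(1) that by (simp add: algebra_simps)
      fix s assume s: "s \<in> {0..t}"
      show "f t - \<epsilon> x - \<delta> x * t - (f s - \<epsilon> x - \<delta> x * s) \<le> w - \<delta> x * (t - u - h)"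
      proof (cases "s \<le> u + h")
        case True
        then have "\<delta> x * s \<le> \<delta> x * (u + h)" using that by simp
        then show ?thesis using w_ge(2)[OF s] by (simp add: algebra_simps)
      next
        case False
        have "\<delta> x * (t - u - h) \<le> \<delta> x * (t + 1)" "\<delta> x * s \<le> \<delta> x * t"
          using that u0 h s by (auto intro!: mult_left_mono)
        moreover have "f t - f s \<le> w - c"
          using c(2)[of s] False s by auto
        ultimately show ?thesis using that by linarith
      qed
    qed
    have upper: "w - \<epsilon> x - \<delta> x * (t - u + h) \<le> skorohod_map (\<lambda>s. f s - \<epsilon> x - \<delta> x * s) t"
      if "\<epsilon> x \<ge> 0" "\<delta> x > 0" for x
    proof (cases "S = {}")
      case True
      obtain s where s: "s \<in> {0..t}" "\<And>r. r \<in> {0..t} \<Longrightarrow> f s \<le> f r"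
        using continuous_attains_inf[of "{0..t}" f] t f by auto
      \<comment> \<open>A nonpositive global minimum would be attained at a point of
        \<open>S\<close>, so the path stays positive. Then \<open>w = f t\<close>, in accordance
        with \<open>u = 0\<close>.\<close>
      have "f s > 0" using True S_iff[of s] s by fastforce
      then have "f t - f r \<le> f t" if "r \<in> {0..t}" for r
        using s(2)[OF that] by simp
      then have "w \<le> f t"
        unfolding w_def by (subst skorohod_map_le_iff[OF t f]) auto
      moreover have "0 \<le> \<delta> x * h" using that h by simp
      ultimately show ?thesis
        using skorohod_map_ge(1)[OF t g, of x] True by (simp add: u_def algebra_simps)
    next
      case False
      have "u - h < Sup S" using False h by (simp add: u_def)
      then obtain s where s: "s \<in> S" "u - h < s"
        using less_cSup_iff[OF False bdd] by auto
      then have st: "0 \<le> s" "s \<le> t" by (auto simp: S_def)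
      \<comment> \<open>Since \<open>s\<close> already minimizes \<open>f\<close> on
        \<open>{0..s}\<close>, a minimizer on \<open>{s..t}\<close> is a global one; it attains
        \<open>w\<close> and lies to the right of \<open>u - h\<close>.\<close>
      obtain r where r: "r \<in> {s..t}" "\<And>q. q \<in> {s..t} \<Longrightarrow> f r \<le> f q"
        using continuous_attains_inf[of "{s..t}" f] continuous_on_subset[OF f, of "{s..t}"] st by auto
      have rs: "f r \<le> f s" "f s \<le> 0" using r(2)[of s] st s(1) S_iff[of s] by auto
      have "f r \<le> f q" if "q \<in> {0..t}" for q
        using s(1) S_iff[of s] rs r(2)[of q] that by (cases "q \<le> s") (auto intro: order_trans)
      then have "w \<le> f t - f r"
        unfolding w_def using rs by (subst skorohod_map_le_iff[OF t f]) auto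
      moreover have "\<delta> x * (u - h) \<le> \<delta> x * r"
        using that s(2) r(1) by (intro mult_left_mono) auto
      ultimately show ?thesis
        using skorohod_map_ge(2)[OF t g, of r x] r(1) st that by (simp add: algebra_simps)
    qed
    have "((\<lambda>x. \<delta> x * (t + 1)) \<longlongrightarrow> 0) F"
      using tendsto_mult_left_zero[OF \<delta>(1)] .
    then have "\<forall>\<^sub>F x in F. \<delta> x * (t + 1) < c"
      using c(1) by (rule order_tendstoD)
    moreover have "\<forall>\<^sub>F x in F. \<epsilon> x / \<delta> x < h"
      using \<epsilon>(2) h by (rule order_tendstoD)
    ultimately show "\<forall>\<^sub>F x in F. dist ((skorohod_map f t -
        skorohod_map (\<lambda>s. f s - \<epsilon> x - \<delta> x * s) t) / \<delta> x) (time_since_zero (skorohod_map f) t) < e"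
      using \<delta>(2) \<epsilon>(1)
    proof eventually_elim
      case (elim x)
      define R where "R = (w - skorohod_map (\<lambda>s. f s - \<epsilon> x - \<delta> x * s) t) / \<delta> x"
      have "(t - u - h) \<le> R"
        using lower[of x] elim by (simp add: R_def field_simps)
      moreover have "R \<le> \<epsilon> x / \<delta> x + (t - u + h)"
      proof -
        have "R \<le> (\<epsilon> x + \<delta> x * (t - u + h)) / \<delta> x"
          unfolding R_def using upper[of x] elim by (intro divide_right_mono) auto
        also have "\<dots> = \<epsilon> x / \<delta> x + (t - u + h)"
          using elim by (simp add: add_divide_distrib)
        finally show ?thesis .
      qed
      ultimately have "\<bar>R - (t - u)\<bar> < e"
        using elim h unfolding h_def by linarith
      then show ?case by (simp add: limit dist_real_def R_def w_def)
    qed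
  qed
qed

section \<open>Tail integrals of functions with power decay\<close>

lemma powr_tail_integral:
  fixes a q :: real
  assumes "a > 0" "q > 0"
  shows "set_integrable lborel {a..} (\<lambda>x. x powr - (q + 1))"
    and "(LBINT x:{a..}. x powr - (q + 1)) = a powr - q / q"
proof -
  have "(\<integral>\<^sup>+x. ennreal (x powr - (q + 1)) * indicator {a..} x \<partial>lborel) = 0 - - (a powr - q / q)"
  proof (rule nn_integral_FTC_atLeast)
    fix x assume "a \<le> x"
    then show "((\<lambda>x. - (x powr - q / q)) has_real_derivative x powr - (q + 1)) (at x)"
      using assms by (auto intro!: derivative_eq_intros simp: powr_diff powr_minus field_simps powr_add)
  next
    have "((\<lambda>x::real. x powr - q) \<longlongrightarrow> 0) at_top"
      using assms by (intro tendsto_neg_powr filterlim_ident) auto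
    from tendsto_minus[OF tendsto_divide[OF this tendsto_const[of q]]]
    show "((\<lambda>x. - (x powr - q / q)) \<longlongrightarrow> 0) at_top"
      using assms by simp
  qed auto
  moreover have "(\<integral>\<^sup>+x. ennreal (x powr - (q + 1)) * indicator {a..} x \<partial>lborel) =
      (\<integral>\<^sup>+x. ennreal (indicator {a..} x * x powr - (q + 1)) \<partial>lborel)"
    by (intro nn_integral_cong) (auto split: split_indicator)
  ultimately have "has_bochner_integral lborel (\<lambda>x. indicator {a..} x * x powr - (q + 1)) (a powr - q / q)"
    using assms by (intro has_bochner_integral_nn_integral) auto
  then show "set_integrable lborel {a..} (\<lambda>x. x powr - (q + 1))"
    and "(LBINT x:{a..}. x powr - (q + 1)) = a powr - q / q"
    by (auto simp: set_integrable_def set_lebesgue_integral_def has_bochner_integral_iff)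
qed

text \<open>Substituting \<open>y = x * t\<close> turns the quotient into the integral of
  \<open>h (x * t) / g x\<close> over \<open>t \<ge> 1\<close>, to which dominated convergence
  applies. The dominating exponent \<open>r\<close> is kept apart from \<open>q\<close> because
  regular variation will supply only a cruder bound than the limit suggests.\<close>

lemma tendsto_tail_integral:
  fixes h g :: "real \<Rightarrow> real"
  assumes [measurable]: "h \<in> borel_measurable borel"
    and q: "q > 0" and r: "r > 0"
    and lim: "\<And>t. t \<ge> 1 \<Longrightarrow> ((\<lambda>x. h (x * t) / g x) \<longlongrightarrow> L * t powr - (q + 1)) at_top"
    and bound: "\<forall>\<^sub>F x in at_top. g x > 0 \<and> (\<forall>t\<ge>1. \<bar>h (x * t)\<bar> \<le> C * t powr - (r + 1) * g x)"
  shows "\<forall>\<^sub>F x in at_top. set_integrable lborel {x..} h"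
    and "((\<lambda>x. (LBINT y:{x..}. h y) / (x * g x)) \<longlongrightarrow> L / q) at_top"
proof -
  note dom = powr_tail_integral(1)[of 1 r, unfolded set_integrable_def, OF zero_less_one r, simplified]
  have scale: "(\<lambda>t. indicator {x..} (x * t) * h (x * t)) = (\<lambda>t. indicator {1..} t * h (x * t))"
    if "x > 0" for x
    using that by (auto simp: fun_eq_iff split: split_indicator)
  show "\<forall>\<^sub>F x in at_top. set_integrable lborel {x..} h"
    using bound eventually_gt_at_top[of 0]
  proof eventually_elim
    case (elim x)
    have "integrable lborel (\<lambda>t. indicator {1..} t * h (x * t))"
    proof (rule Bochner_Integration.integrable_bound)
      show "integrable lborel (\<lambda>t. C * g x * (indicator {1..} t * t powr - (r + 1)))"
        using dom by (intro integrable_mult_right) simp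
      show "AE t in lborel. norm (indicator {1..} t * h (x * t)) \<le>
          norm (C * g x * (indicator {1..} t * t powr - (r + 1)))"
        using elim by (intro AE_I2) (fastforce simp: algebra_simps split: split_indicator)
    qed auto
    then show ?case
      using elim lborel_integrable_real_affine_iff[of x "\<lambda>y. indicator {x..} y * h y" 0]
      by (simp add: scale set_integrable_def)
  qed
  have "((\<lambda>x. LBINT t. indicator {1..} t * (h (x * t) / g x)) \<longlongrightarrow>
      (LBINT t. indicator {1..} t * (L * t powr - (q + 1)))) at_top"
  proof (rule integral_dominated_convergence_at_top)
    show "integrable lborel (\<lambda>t. C * (indicator {1..} t * t powr - (r + 1)))"
      using dom by (intro integrable_mult_right) simp
    show "\<forall>\<^sub>F x in at_top. AE t in lborel. norm (indicator {1..} t * (h (x * t) / g x)) \<le>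
        C * (indicator {1..} t * t powr - (r + 1))"
      using bound by eventually_elim (auto simp: field_simps split: split_indicator)
    show "AE t in lborel. ((\<lambda>x. indicator {1..} t * (h (x * t) / g x)) \<longlongrightarrow>
        indicator {1..} t * (L * t powr - (q + 1))) at_top"
      using lim by (intro AE_I2) (auto split: split_indicator)
  qed auto
  moreover have "(LBINT t. indicator {1..} t * (L * t powr - (q + 1))) = L / q"
    using powr_tail_integral(2)[of 1 q] q
    by (simp add: set_lebesgue_integral_def mult.left_commute[of _ L])
  moreover have "\<forall>\<^sub>F x in at_top. (LBINT t. indicator {1..} t * (h (x * t) / g x)) =
      (LBINT y:{x..}. h y) / (x * g x)"
    using eventually_gt_at_top[of 0]
  proof eventually_elim
    case (elim x)
    show ?case
      using elim lborel_integral_real_affine[of x "\<lambda>y. indicator {x..} y * h y" 0]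
      by (simp add: scale set_lebesgue_integral_def)
  qed
  ultimately show "((\<lambda>x. (LBINT y:{x..}. h y) / (x * g x)) \<longlongrightarrow> L / q) at_top"
    by (auto intro: Lim_transform_eventually)
qed

text \<open>The case of a pure power as comparison function: convergence itself bounds
  \<open>x powr (q + 1) * h x\<close> by \<open>\<bar>c\<bar> + 1\<close> eventually, which is the
  required domination with \<open>r = q\<close>. The limit \<open>c\<close> may be 0.\<close>

lemma tendsto_powr_tail_integral:
  fixes h :: "real \<Rightarrow> real"
  assumes h: "h \<in> borel_measurable borel" and q: "q > 0"
    and lim: "((\<lambda>x. x powr (q + 1) * h x) \<longlongrightarrow> c) at_top"
  shows "\<forall>\<^sub>F x in at_top. set_integrable lborel {x..} h"
    and "((\<lambda>x. x powr q * (LBINT y:{x..}. h y)) \<longlongrightarrow> c / q) at_top"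
proof -
  have lim': "((\<lambda>x. h (x * t) / x powr - (q + 1)) \<longlongrightarrow> c * t powr - (q + 1)) at_top" if "t \<ge> 1" for t
  proof -
    have "filterlim (\<lambda>x. x * t) at_top at_top"
      using that by (intro filterlim_at_top_mult_tendsto_pos[OF tendsto_const] filterlim_ident) auto
    from tendsto_mult_right[OF filterlim_compose[OF lim this], of "t powr - (q + 1)"]
    show ?thesis
    proof (rule Lim_transform_eventually)
      show "\<forall>\<^sub>F x in at_top. (x * t) powr (q + 1) * h (x * t) * t powr - (q + 1) = h (x * t) / x powr - (q + 1)"
        using eventually_gt_at_top[of 0]
        by eventually_elim (use that in \<open>simp only: powr_minus, simp add: powr_mult field_simps\<close>)
    qed
  qed
  have "\<forall>\<^sub>F x in at_top. \<bar>x powr (q + 1) * h x\<bar> < \<bar>c\<bar> + 1"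
    using tendsto_rabs[OF lim] by (rule order_tendstoD) simp
  then obtain x0 where x0: "\<And>x. x \<ge> x0 \<Longrightarrow> \<bar>x powr (q + 1) * h x\<bar> < \<bar>c\<bar> + 1"
    by (auto simp: eventually_at_top_linorder)
  have bound: "\<forall>\<^sub>F x in at_top. x powr - (q + 1) > 0 \<and>
      (\<forall>t\<ge>1. \<bar>h (x * t)\<bar> \<le> (\<bar>c\<bar> + 1) * t powr - (q + 1) * x powr - (q + 1))"
    using eventually_gt_at_top[of 0] eventually_ge_at_top[of x0]
  proof eventually_elim
    case (elim x)
    have "\<bar>h (x * t)\<bar> \<le> (\<bar>c\<bar> + 1) * t powr - (q + 1) * x powr - (q + 1)" if "t \<ge> 1" for t
    proof -
      have "x * 1 \<le> x * t" using that elim by (intro mult_left_mono) auto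
      with elim(2) have "x0 \<le> x * t" by linarith
      then have "(x * t) powr (q + 1) * \<bar>h (x * t)\<bar> \<le> \<bar>c\<bar> + 1"
        using x0[of "x * t"] by (simp add: abs_mult)
      then show ?thesis
        unfolding powr_minus using that elim by (simp add: powr_mult field_simps)
    qed
    then show ?case using elim by simp
  qed
  show "\<forall>\<^sub>F x in at_top. set_integrable lborel {x..} h"
    by (rule tendsto_tail_integral(1)[OF h q q lim' bound])
  have "((\<lambda>x. (LBINT y:{x..}. h y) / (x * x powr - (q + 1))) \<longlongrightarrow> c / q) at_top"
    by (rule tendsto_tail_integral(2)[OF h q q lim' bound])
  then show "((\<lambda>x. x powr q * (LBINT y:{x..}. h y)) \<longlongrightarrow> c / q) at_top"
  proof (rule Lim_transform_eventually)
    show "\<forall>\<^sub>F x in at_top. (LBINT y:{x..}. h y) / (x * x powr - (q + 1)) = x powr q * (LBINT y:{x..}. h y)"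
      using eventually_gt_at_top[of 0]
      by eventually_elim (simp only: powr_minus, simp add: powr_add field_simps)
  qed
qed

section \<open>Truncated first moments\<close>

text \<open>Where \<open>f \<omega> \<ge> a\<close>, the value \<open>f \<omega>\<close> is
  \<open>a\<close> plus the length of \<open>{a..f \<omega>}\<close>; integrating this and
  exchanging the integrals gives the formula. Nonnegative integrals make integrability part of the
  conclusion. It serves both the processing time and the identity under the limit measure.\<close>

lemma (in finite_measure) truncated_moment_layer_cake:
  fixes f :: "'a \<Rightarrow> real" and G :: "real \<Rightarrow> real"
  defines "G \<equiv> \<lambda>x. measure M {\<omega> \<in> space M. x \<le> f \<omega>}"
  assumes [measurable]: "f \<in> borel_measurable M" and a: "a \<ge> 0"
    and G: "set_integrable lborel {a..} G"
  shows "integrable M (\<lambda>\<omega>. f \<omega> * indicator {a..} (f \<omega>))"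
    and "(\<integral>\<omega>. f \<omega> * indicator {a..} (f \<omega>) \<partial>M) = a * G a + (LBINT x:{a..}. G x)"
proof -
  interpret pair_sigma_finite M lborel ..
  have G0: "0 \<le> G x" for x by (simp add: G_def)
  have I0: "0 \<le> (LBINT x:{a..}. G x)"
    unfolding set_lebesgue_integral_def by (intro integral_nonneg_AE AE_I2) (simp add: G0)
  have "(\<integral>\<^sup>+\<omega>. ennreal (f \<omega> * indicator {a..} (f \<omega>)) \<partial>M) =
      (\<integral>\<^sup>+\<omega>. ennreal a * indicator {\<omega> \<in> space M. a \<le> f \<omega>} \<omega> +
        (\<integral>\<^sup>+x. indicator {x. a \<le> x \<and> x \<le> f \<omega>} x \<partial>lborel) \<partial>M)"
  proof (intro nn_integral_cong)
    fix \<omega> assume "\<omega> \<in> space M"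
    moreover have "{x. a \<le> x \<and> x \<le> f \<omega>} = {a..f \<omega>}" by auto
    ultimately show "ennreal (f \<omega> * indicator {a..} (f \<omega>)) =
        ennreal a * indicator {\<omega> \<in> space M. a \<le> f \<omega>} \<omega> +
        (\<integral>\<^sup>+x. indicator {x. a \<le> x \<and> x \<le> f \<omega>} x \<partial>lborel)"
      using a by (auto simp: ennreal_plus[symmetric] simp del: ennreal_plus split: split_indicator)
  qed
  also have "\<dots> = ennreal a * emeasure M {\<omega> \<in> space M. a \<le> f \<omega>} +
      (\<integral>\<^sup>+\<omega>. \<integral>\<^sup>+x. indicator {x. a \<le> x \<and> x \<le> f \<omega>} x \<partial>lborel \<partial>M)"
    by (subst nn_integral_add) (auto simp: nn_integral_cmult)
  also have "(\<integral>\<^sup>+\<omega>. \<integral>\<^sup>+x. indicator {x. a \<le> x \<and> x \<le> f \<omega>} x \<partial>lborel \<partial>M) =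
      (\<integral>\<^sup>+x. \<integral>\<^sup>+\<omega>. indicator {x. a \<le> x \<and> x \<le> f \<omega>} x \<partial>M \<partial>lborel)"
    by (intro Fubini'[symmetric]) measurable
  also have "\<dots> = (\<integral>\<^sup>+x. ennreal (indicator {a..} x * G x) \<partial>lborel)"
  proof (intro nn_integral_cong)
    fix x :: real
    have "(\<integral>\<^sup>+\<omega>. indicator {x. a \<le> x \<and> x \<le> f \<omega>} x \<partial>M) =
        (\<integral>\<^sup>+\<omega>. indicator {a..} x * indicator {\<omega> \<in> space M. x \<le> f \<omega>} \<omega> \<partial>M)"
      by (intro nn_integral_cong) (auto split: split_indicator)
    also have "\<dots> = indicator {a..} x * emeasure M {\<omega> \<in> space M. x \<le> f \<omega>}"
      by (simp add: nn_integral_cmult)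
    also have "\<dots> = ennreal (indicator {a..} x * G x)"
      by (simp add: emeasure_eq_measure G_def split: split_indicator)
    finally show "(\<integral>\<^sup>+\<omega>. indicator {x. a \<le> x \<and> x \<le> f \<omega>} x \<partial>M) = ennreal (indicator {a..} x * G x)" .
  qed
  also have "\<dots> = ennreal (LBINT x:{a..}. G x)"
    using G unfolding set_integrable_def set_lebesgue_integral_def
    by (subst nn_integral_eq_integral) (auto simp: G0)
  also have "ennreal a * emeasure M {\<omega> \<in> space M. a \<le> f \<omega>} = ennreal (a * G a)"
    using a by (simp add: emeasure_eq_measure G_def ennreal_mult)
  also have "ennreal (a * G a) + ennreal (LBINT x:{a..}. G x) = ennreal (a * G a + (LBINT x:{a..}. G x))"
    using a G0 I0 by (intro ennreal_plus[symmetric]) auto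
  finally have "has_bochner_integral M (\<lambda>\<omega>. f \<omega> * indicator {a..} (f \<omega>)) (a * G a + (LBINT x:{a..}. G x))"
    using a G0 I0 by (intro has_bochner_integral_nn_integral) (auto split: split_indicator)
  then show "integrable M (\<lambda>\<omega>. f \<omega> * indicator {a..} (f \<omega>))"
    and "(\<integral>\<omega>. f \<omega> * indicator {a..} (f \<omega>) \<partial>M) = a * G a + (LBINT x:{a..}. G x)"
    by (auto simp: has_bochner_integral_iff)
qed

lemma (in finite_measure) borel_measurable_upper_tail:
  fixes f :: "'a \<Rightarrow> real"
  assumes [measurable]: "f \<in> borel_measurable M"
  shows "(\<lambda>x. measure M {\<omega> \<in> space M. x \<le> f \<omega>}) \<in> borel_measurable borel"
proof -
  have "mono (\<lambda>x. - measure M {\<omega> \<in> space M. x \<le> f \<omega>})"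
    by (auto simp: mono_def intro!: finite_measure_mono)
  from borel_measurable_mono[OF this] show ?thesis
    using borel_measurable_uminus_eq by blast
qed

section \<open>Tail of the limit measure at a fixed time and sample point\<close>

text \<open>The boundary term of the tail mass contributes \<open>c\<close> and the integral takes
  away \<open>c / (q + 1)\<close>, which leaves \<open>c * q / (q + 1)\<close>. The layer-cake
  formula then multiplies this by \<open>1 + 1 / q\<close>, and the first moment regains the
  constant \<open>c\<close>.\<close>

lemma limit_measure_tail:
  fixes w :: "real \<Rightarrow> real"
  assumes mu: "is_limit_measure w mu"
    and mono: "mono_on {0<..} w" and le: "\<forall>x>0. w x \<le> winf"
    and q: "q > 0" and lim: "((\<lambda>x. x powr q * (winf - w x)) \<longlongrightarrow> c) at_top"
  shows "((\<lambda>a. a powr (q + 1) * measure mu {a..}) \<longlongrightarrow> c * q / (q + 1)) at_top"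
    and "a > 0 \<Longrightarrow> integrable mu (\<lambda>x. x * indicator {a..} x)"
    and "((\<lambda>a. a powr q * (\<integral>x. x * indicator {a..} x \<partial>mu)) \<longlongrightarrow> c) at_top"
proof -
  \<comment> \<open>Monotonicity controls \<open>w\<close> only at positive arguments; the indicator
    makes \<open>h\<close> Borel on the whole line.\<close>
  define h where "h = (\<lambda>x. indicator {0<..} x * (winf - w x) / x\<^sup>2)"
  have sets_mu: "sets mu = sets (restrict_space borel {0..})"
    and Icc: "\<And>a b. 0 < a \<Longrightarrow> a < b \<Longrightarrow> measure mu {a..b} = (LBINT x:{a..b}. w x / x\<^sup>2) + w b / b - w a / a"
    using mu by (auto simp: is_limit_measure_def)
  interpret finite_measure mu
    using mu by (simp add: is_limit_measure_def)
  have space_mu: "space mu = {0..}"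
    using sets_eq_imp_space_eq[OF sets_mu] by (simp add: space_restrict_space)
  have in_sets: "A \<in> sets mu" if "A \<in> sets borel" "A \<subseteq> {0..}" for A
    using that by (auto simp: sets_mu sets_restrict_space_iff)
  have id_measurable[measurable]: "(\<lambda>x. x) \<in> borel_measurable mu"
    unfolding measurable_cong_sets[OF sets_mu refl] by (intro measurable_restrict_space1) simp
  have "(\<lambda>x. w x * indicator {0<..} x) \<in> borel_measurable borel"
    using borel_measurable_mono_on_fnc[OF mono]
    by (subst (asm) borel_measurable_restrict_space_iff) (auto simp: mult.commute)
  moreover have "h = (\<lambda>x. (indicator {0<..} x * winf - w x * indicator {0<..} x) / x\<^sup>2)"
    by (auto simp: h_def fun_eq_iff split: split_indicator)
  ultimately have h[measurable]: "h \<in> borel_measurable borel" by simp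
  have lim_h: "((\<lambda>x. x powr (q + 1 + 1) * h x) \<longlongrightarrow> c) at_top"
    using lim
  proof (rule Lim_transform_eventually)
    show "\<forall>\<^sub>F x in at_top. x powr q * (winf - w x) = x powr (q + 1 + 1) * h x"
      using eventually_gt_at_top[of 0]
      by eventually_elim (simp add: h_def powr_add field_simps power2_eq_square)
  qed
  have q1: "q + 1 > 0" using q by simp
  note h_int = tendsto_powr_tail_integral[OF h q1 lim_h]
  have w_lim: "(w \<longlongrightarrow> winf) at_top"
  proof -
    have "((\<lambda>x. x powr - q * (x powr q * (winf - w x))) \<longlongrightarrow> 0 * c) at_top"
      using q by (intro tendsto_mult tendsto_neg_powr filterlim_ident lim) auto
    moreover have "\<forall>\<^sub>F x in at_top. winf - x powr - q * (x powr q * (winf - w x)) = w x"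
      using eventually_gt_at_top[of 0] by eventually_elim (simp add: powr_minus field_simps)
    ultimately show ?thesis
      using Lim_transform_eventually[OF tendsto_diff[OF tendsto_const[of winf]]] by fastforce
  qed
  have tail: "\<forall>\<^sub>F a in at_top. measure mu {a..} = (winf - w a) / a - (LBINT x:{a..}. h x)"
    using h_int(1) eventually_gt_at_top[of 0]
  proof eventually_elim
    case (elim a)
    \<comment> \<open>The function \<open>winf / x\<^sup>2\<close> is written with exponent
      \<open>- (1 + 1)\<close> to match the power integral at \<open>q = 1\<close>.\<close>
    have inv: "set_integrable lborel {a..} (\<lambda>x. winf * x powr - (1 + 1))"
      "(LBINT x:{a..}. winf * x powr - (1 + 1)) = winf / a"
      using powr_tail_integral[OF elim(2) zero_less_one] elim(2)
      by (simp_all only: set_integrable_mult_right set_integral_mult_right)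
        (simp add: powr_minus field_simps)
    have split: "w x / x\<^sup>2 = winf * x powr - (1 + 1) - h x" if "x \<in> {a..}" for x
      using that elim by (simp add: h_def powr_minus field_simps)
    have "set_integrable lborel {a..} (\<lambda>x. winf * x powr - (1 + 1) - h x)"
      using inv(1) elim by (intro set_integral_diff)
    then have int: "set_integrable lborel {a..} (\<lambda>x. w x / x\<^sup>2)"
      by (subst set_integrable_cong[OF refl refl split]) auto
    have "(LBINT x:{a..}. w x / x\<^sup>2) = (LBINT x:{a..}. winf * x powr - (1 + 1) - h x)"
      by (intro set_lebesgue_integral_cong) (auto simp: split)
    also have "\<dots> = winf / a - (LBINT x:{a..}. h x)"
      using inv elim by (subst set_integral_diff) auto
    finally have val: "(LBINT x:{a..}. w x / x\<^sup>2) = winf / a - (LBINT x:{a..}. h x)" .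
    have "((\<lambda>b. (LBINT x:{a..b}. w x / x\<^sup>2) + w b / b - w a / a) \<longlongrightarrow>
        (LBINT x:{a..}. w x / x\<^sup>2) + 0 - w a / a) at_top"
      by (intro tendsto_intros tendsto_set_lebesgue_integral_at_top int
          real_tendsto_divide_at_top[OF w_lim] filterlim_ident) auto
    \<comment> \<open>Continuity from below asks for a sequence of right endpoints; the summand 1
      keeps them strictly above \<open>a\<close>, as \<open>Icc\<close> demands, already at
      \<open>n = 0\<close>.\<close>
    moreover have "filterlim (\<lambda>n. a + 1 + real n) at_top sequentially"
      by (rule filterlim_tendsto_add_at_top[OF tendsto_const filterlim_real_sequentially])
    ultimately have "(\<lambda>n. (LBINT x:{a..a + 1 + real n}. w x / x\<^sup>2) + w (a + 1 + real n) / (a + 1 + real n) - w a / a)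
        \<longlonglongrightarrow> (LBINT x:{a..}. w x / x\<^sup>2) + 0 - w a / a"
      by (rule filterlim_compose)
    then have "(\<lambda>n. measure mu {a..a + 1 + real n}) \<longlonglongrightarrow> (LBINT x:{a..}. w x / x\<^sup>2) - w a / a"
      using elim by (simp add: Icc)
    moreover have "(\<lambda>n. measure mu {a..a + 1 + real n}) \<longlonglongrightarrow> measure mu (\<Union>n. {a..a + 1 + real n})"
      using elim by (intro finite_Lim_measure_incseq) (auto intro!: in_sets simp: incseq_def)
    moreover have "(\<Union>n. {a..a + 1 + real n}) = {a..}"
    proof safe
      fix x assume "a \<le> x"
      moreover obtain n where "x - a - 1 \<le> real n" using real_arch_simple by blast
      ultimately show "x \<in> (\<Union>n. {a..a + 1 + real n})" by (auto intro!: exI[of _ n])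
    qed auto
    ultimately have "measure mu {a..} = (LBINT x:{a..}. w x / x\<^sup>2) - w a / a"
      using LIMSEQ_unique by auto
    then show ?case by (simp add: val diff_divide_distrib)
  qed
  have "((\<lambda>a. a powr q * (winf - w a) - a powr (q + 1) * (LBINT x:{a..}. h x)) \<longlongrightarrow> c - c / (q + 1)) at_top"
    by (intro tendsto_diff lim h_int(2))
  then show meas: "((\<lambda>a. a powr (q + 1) * measure mu {a..}) \<longlongrightarrow> c * q / (q + 1)) at_top"
  proof (rule Lim_transform_eventually[where f = "\<lambda>a. a powr q * (winf - w a) - _ a", THEN tendsto_eq_rhs])
    show "\<forall>\<^sub>F a in at_top. a powr q * (winf - w a) - a powr (q + 1) * (LBINT x:{a..}. h x) =
        a powr (q + 1) * measure mu {a..}"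
      using tail eventually_gt_at_top[of 0]
    proof eventually_elim
      case (elim a)
      then have "winf - w a = a * (measure mu {a..} + (LBINT x:{a..}. h x))"
        by (simp add: field_simps)
      then show ?case using elim(2) by (simp add: powr_add algebra_simps)
    qed
    show "c - c / (q + 1) = c * q / (q + 1)" using q by (simp add: field_simps)
  qed
  \<comment> \<open>For negative \<open>x\<close> the ray \<open>{x..}\<close> leaves the space of
    \<open>mu\<close>, hence the intersection with \<open>space mu\<close>.\<close>
  define G where "G = (\<lambda>x. measure mu {y \<in> space mu. x \<le> y})"
  have G_eq: "G x = measure mu {x..}" if "x > 0" for x
    using that by (auto simp: G_def space_mu intro!: arg_cong[of _ _ "measure mu"])
  have G_meas: "G \<in> borel_measurable borel"
    unfolding G_def by (rule borel_measurable_upper_tail) simp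
  have lim_G: "((\<lambda>a. a powr (q + 1) * G a) \<longlongrightarrow> c * q / (q + 1)) at_top"
    by (rule Lim_transform_eventually[OF meas])
      (use eventually_gt_at_top[of 0] in \<open>eventually_elim, simp add: G_eq\<close>)
  note G_int = tendsto_powr_tail_integral[OF G_meas q lim_G]
  have cake: "\<forall>\<^sub>F a in at_top. integrable mu (\<lambda>x. x * indicator {a..} x) \<and>
      (\<integral>x. x * indicator {a..} x \<partial>mu) = a * G a + (LBINT x:{a..}. G x)"
    using G_int(1) eventually_gt_at_top[of 0]
    by eventually_elim
      (use truncated_moment_layer_cake[OF id_measurable] in \<open>simp add: G_def less_imp_le\<close>)
  have "((\<lambda>a. a powr (q + 1) * G a + a powr q * (LBINT x:{a..}. G x)) \<longlongrightarrow>
      c * q / (q + 1) + c * q / (q + 1) / q) at_top"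
    by (intro tendsto_add lim_G G_int(2))
  then show "((\<lambda>a. a powr q * (\<integral>x. x * indicator {a..} x \<partial>mu)) \<longlongrightarrow> c) at_top"
  proof (rule Lim_transform_eventually[THEN tendsto_eq_rhs])
    show "\<forall>\<^sub>F a in at_top. a powr (q + 1) * G a + a powr q * (LBINT x:{a..}. G x) =
        a powr q * (\<integral>x. x * indicator {a..} x \<partial>mu)"
      using cake eventually_gt_at_top[of 0] by eventually_elim (simp add: powr_add field_simps)
    have "c * q / (q + 1) + c * q / (q + 1) / q = c * (q + 1) / (q + 1)"
      using q by (simp add: add_divide_distrib distrib_left del: nonzero_mult_div_cancel_right)
    also have "\<dots> = c" using q by (subst nonzero_mult_div_cancel_right) auto
    finally show "c * q / (q + 1) + c * q / (q + 1) / q = c" .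
  qed
  show "integrable mu (\<lambda>x. x * indicator {a..} x)" if "a > 0"
  proof -
    \<comment> \<open>The layer-cake formula yields integrability only for large thresholds. Below
      such a \<open>b\<close> the integrand is at most \<open>b\<close>, and constants are
      integrable for a finite measure.\<close>
    obtain b where b: "b \<ge> a" "integrable mu (\<lambda>x. x * indicator {b..} x)"
      using eventually_happens[OF eventually_conj[OF eventually_ge_at_top[of a] cake]] by auto
    show ?thesis
    proof (rule Bochner_Integration.integrable_bound)
      show "integrable mu (\<lambda>x. b + x * indicator {b..} x)"
        using b(2) by simp
      have "{a..} \<in> sets mu" using that by (intro in_sets) auto
      then show "(\<lambda>x. x * indicator {a..} x) \<in> borel_measurable mu" by simp
      show "AE x in mu. norm (x * indicator {a..} x) \<le> norm (b + x * indicator {b..} x)"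
        using that b(1) by (intro AE_I2) (auto split: split_indicator)
    qed
  qed
qed

section \<open>Regular variation and the conditional mean of the processing time\<close>

text \<open>Karamata's theorem for a nonincreasing function of index \<open>- (q + 1)\<close>, by
  dominated convergence with \<open>g\<close> as its own normalization. The limit carries the
  exponent \<open>q\<close>, the domination only the exponent 1.\<close>

lemma regularly_varying_tail_integral:
  fixes g :: "real \<Rightarrow> real"
  assumes anti: "antimono g" and pos: "\<And>x. x > 0 \<Longrightarrow> g x > 0" and q: "q > 1"
    and rv: "\<And>t. t > 0 \<Longrightarrow> ((\<lambda>x. g (t * x) / g x) \<longlongrightarrow> t powr - (q + 1)) at_top"
  shows "\<forall>\<^sub>F x in at_top. set_integrable lborel {x..} g"
    and "((\<lambda>x. (LBINT y:{x..}. g y) / (x * g x)) \<longlongrightarrow> 1 / q) at_top"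
proof -
  have "mono (\<lambda>x. - g x)" using anti by (auto simp: mono_def antimono_def)
  from borel_measurable_mono[OF this] have g: "g \<in> borel_measurable borel"
    using borel_measurable_uminus_eq by blast
  \<comment> \<open>Doubling eventually divides \<open>g\<close> by more than 4; iterating this yields the integrable bound \<open>4 / t\<^sup>2\<close>
    on \<open>g (x * t) / g x\<close> (a weak form of Potter's bound).\<close>
  have "(2::real) powr - (q + 1) < 2 powr - 2"
    using q by (intro powr_less_mono) auto
  then have "(2::real) powr - (q + 1) < 1 / 4" by (simp add: powr_minus)
  then have "\<forall>\<^sub>F x in at_top. g (2 * x) / g x < 1 / 4"
    using rv[of 2] by (intro order_tendstoD) auto
  then obtain x0 where x0: "\<And>x. x \<ge> x0 \<Longrightarrow> g (2 * x) / g x < 1 / 4"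
    by (auto simp: eventually_at_top_linorder)
  have dbl: "g (2 ^ k * x) \<le> g x / 4 ^ k" if "x \<ge> x0" "x > 0" for x k
  proof (induction k)
    case (Suc k)
    have "1 * x \<le> 2 ^ k * x" using that by (intro mult_right_mono) auto
    then have "x0 \<le> 2 ^ k * x" using that by linarith
    then have "g (2 * (2 ^ k * x)) \<le> g (2 ^ k * x) / 4"
      using x0[of "2 ^ k * x"] pos[of "2 ^ k * x"] that by (simp add: field_simps)
    also have "g (2 ^ k * x) / 4 \<le> g x / 4 ^ k / 4"
      using Suc by (intro divide_right_mono) auto
    finally show ?case by (simp add: ac_simps)
  qed simp
  have bound: "\<forall>\<^sub>F x in at_top. g x > 0 \<and> (\<forall>t\<ge>1. \<bar>g (x * t)\<bar> \<le> 4 * t powr - (1 + 1) * g x)"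
    using eventually_gt_at_top[of 0] eventually_ge_at_top[of x0]
  proof eventually_elim
    case (elim x)
    have "\<bar>g (x * t)\<bar> \<le> 4 * t powr - (1 + 1) * g x" if t: "t \<ge> 1" for t
    proof -
      \<comment> \<open>Dyadic bracketing \<open>2 ^ k \<le> t < 2 ^ (k + 1)\<close>: monotonicity
        and \<open>k\<close> doublings give \<open>g x / 4 ^ k\<close>, and
        \<open>t\<^sup>2 \<le> 4 * 4 ^ k\<close> produces the constant 4.\<close>
      define m where "m = (LEAST m. t < 2 ^ m)"
      have "\<exists>m. t < 2 ^ m" by (rule real_arch_pow) simp
      then have m: "t < 2 ^ m" unfolding m_def by (rule LeastI_ex)
      then have "m \<noteq> 0" using t by (intro notI) simp
      then obtain k where k: "m = Suc k" using not0_implies_Suc by blast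
      have tk: "2 ^ k \<le> t" using not_less_Least[of k "\<lambda>m. t < 2 ^ m"] k by (simp add: m_def)
      have "g (x * t) \<le> g (2 ^ k * x)"
        using tk elim by (intro antimonoD[OF anti]) (simp add: mult.commute)
      also have "\<dots> \<le> g x / 4 ^ k" using dbl elim by simp
      also have "\<dots> \<le> 4 * t powr - (1 + 1) * g x"
      proof -
        have "t\<^sup>2 \<le> (2 ^ m)\<^sup>2" using m t by (intro power_mono) auto
        also have "\<dots> = 4 * 4 ^ k" by (simp add: k power_mult_distrib power2_eq_square flip: power_mult_distrib)
        finally have "1 / 4 ^ k \<le> 4 / t\<^sup>2" using t by (simp add: field_simps)
        from mult_right_mono[OF this, of "g x"] show ?thesis
          using pos[of x] elim t by (simp add: powr_minus field_simps)
      qed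
      finally show ?thesis using pos[of "x * t"] elim t by simp
    qed
    then show ?case using pos elim by simp
  qed
  have lim: "((\<lambda>x. g (x * t) / g x) \<longlongrightarrow> 1 * t powr - (q + 1)) at_top" if "t \<ge> 1" for t
    using rv[of t] that by (simp add: mult.commute)
  have q0: "q > 0" using q by simp
  show "\<forall>\<^sub>F x in at_top. set_integrable lborel {x..} g"
    by (rule tendsto_tail_integral(1)[OF g q0 zero_less_one lim bound])
  show "((\<lambda>x. (LBINT y:{x..}. g y) / (x * g x)) \<longlongrightarrow> 1 / q) at_top"
    by (rule tendsto_tail_integral(2)[OF g q0 zero_less_one lim bound])
qed

text \<open>By the layer-cake formula the conditional mean divided by \<open>a\<close> is 1 plus the
  Karamata quotient, whose limit is \<open>1 / p\<close>. Positivity of the mean will give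
  \<open>lam > 0\<close>.\<close>

lemma regularly_varying_moments:
  fixes v :: "'b \<Rightarrow> real" and Fbar :: "real \<Rightarrow> real"
  assumes "prob_space N" and v[measurable]: "v \<in> borel_measurable N" and v_pos: "AE \<omega> in N. v \<omega> > 0"
    and cont: "continuous_on UNIV (cdf (distr N borel v))"
    and Fbar: "Fbar = (\<lambda>x. 1 - cdf (distr N borel v) x)"
    and pos: "\<And>t. t > 0 \<Longrightarrow> Fbar t > 0"
    and rv: "\<And>t. t > 0 \<Longrightarrow> ((\<lambda>x. Fbar (t * x) / Fbar x) \<longlongrightarrow> t powr - (p + 1)) at_top"
    and p: "p > 1"
  shows "prob_space.expectation N v > 0"
    "((\<lambda>a. cond_exp_ge N v a / a) \<longlongrightarrow> (p + 1) / p) at_top"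
proof -
  interpret N: prob_space N by fact
  interpret D: real_distribution "distr N borel v" by (rule N.real_distribution_distr) simp
  \<comment> \<open>Continuity of the distribution function excludes atoms, so \<open>v > x\<close>
    and \<open>v \<ge> x\<close> have equal probability.\<close>
  have Fbar_eq: "measure N {\<omega> \<in> space N. x \<le> v \<omega>} = Fbar x" for x
  proof -
    have "isCont (cdf (distr N borel v)) x"
      using cont by (simp add: continuous_on_eq_continuous_at)
    then have null: "measure (distr N borel v) {x} = 0" by (simp add: D.isCont_cdf)
    have "measure N {\<omega> \<in> space N. x \<le> v \<omega>} = measure (distr N borel v) ({x} \<union> {x<..})"
      by (subst measure_distr) (auto intro!: arg_cong[of _ _ "measure N"])
    also have "\<dots> = measure (distr N borel v) {x<..}"
      using null by (subst D.finite_measure_Union) auto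
    also have "{x<..} = space (distr N borel v) - {..x}" by auto
    also have "measure (distr N borel v) \<dots> = Fbar x"
      by (subst D.prob_compl) (auto simp: Fbar cdf_def)
    finally show ?thesis .
  qed
  have anti: "antimono Fbar"
    by (auto simp: antimono_def Fbar_eq[symmetric] intro!: N.finite_measure_mono)
  have tail: "\<forall>\<^sub>F x in at_top. set_integrable lborel {x..} Fbar"
    "((\<lambda>x. (LBINT y:{x..}. Fbar y) / (x * Fbar x)) \<longlongrightarrow> 1 / p) at_top"
    by (rule regularly_varying_tail_integral[OF anti pos p rv]; assumption)+
  note cake = N.truncated_moment_layer_cake[OF v, unfolded Fbar_eq]
  \<comment> \<open>Integrability has to precede positivity of the mean, since the integral of a
    nonintegrable function is 0 by convention. It reduces to the truncated moment because
    \<open>v\<close> is bounded by \<open>b\<close> elsewhere.\<close>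
  obtain b where b: "b > 0" "integrable N (\<lambda>\<omega>. v \<omega> * indicator {b..} (v \<omega>))"
    using eventually_happens[OF eventually_conj[OF eventually_gt_at_top[of 0] tail(1)]] cake(1) by force
  have int: "integrable N v"
  proof (rule Bochner_Integration.integrable_bound)
    show "integrable N (\<lambda>\<omega>. b + v \<omega> * indicator {b..} (v \<omega>))" using b(2) by simp
    show "AE \<omega> in N. norm (v \<omega>) \<le> norm (b + v \<omega> * indicator {b..} (v \<omega>))"
      using v_pos by eventually_elim (use b(1) in \<open>auto split: split_indicator\<close>)
  qed simp
  have nonneg: "AE \<omega> in N. 0 \<le> v \<omega>" using v_pos by eventually_elim simp
  have "N.expectation v \<noteq> 0"
  proof
    assume "N.expectation v = 0"
    then have "AE \<omega> in N. v \<omega> = 0"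
      using integral_nonneg_eq_0_iff_AE[OF int nonneg] by simp
    with v_pos have "AE \<omega> in N. False" by eventually_elim simp
    then show False by simp
  qed
  with integral_nonneg_AE[OF nonneg] show "N.expectation v > 0" by simp
  have "((\<lambda>a. 1 + (LBINT y:{a..}. Fbar y) / (a * Fbar a)) \<longlongrightarrow> 1 + 1 / p) at_top"
    by (intro tendsto_add tendsto_const tail(2))
  then show "((\<lambda>a. cond_exp_ge N v a / a) \<longlongrightarrow> (p + 1) / p) at_top"
  proof (rule Lim_transform_eventually[THEN tendsto_eq_rhs])
    show "\<forall>\<^sub>F a in at_top. 1 + (LBINT y:{a..}. Fbar y) / (a * Fbar a) = cond_exp_ge N v a / a"
      using tail(1) eventually_gt_at_top[of 0]
    proof eventually_elim
      case (elim a)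
      have "(\<integral>\<omega>. v \<omega> * indicator {\<omega> \<in> space N. a \<le> v \<omega>} \<omega> \<partial>N) =
          (\<integral>\<omega>. v \<omega> * indicator {a..} (v \<omega>) \<partial>N)"
        by (intro Bochner_Integration.integral_cong) (auto split: split_indicator)
      also have "\<dots> = a * Fbar a + (LBINT y:{a..}. Fbar y)"
        using cake(2)[of a] elim by simp
      finally have "cond_exp_ge N v a = (a * Fbar a + (LBINT y:{a..}. Fbar y)) / Fbar a"
        by (simp add: cond_exp_ge_def Fbar_eq)
      then show ?case using pos[of a] elim by (simp add: field_simps)
    qed
    show "1 + 1 / p = (p + 1) / p" using p by (simp add: field_simps)
  qed
qed

section \<open>Workload paths as perturbations of the limiting path\<close>

text \<open>Raising the threshold raises both the starting value and the slope, so differences of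
  the paths are nonnegative and nondecreasing in time, and the comparison lemma applies. The rate is
  the perturbation lemma with slope \<open>lam * a powr - p\<close> and shift
  \<open>value_at_infinity x - x a\<close>; \<open>lim\<close> says that the shift is negligible
  against the slope.\<close>

lemma tendsto_W_path:
  fixes \<sigma> \<kappa> :: real
  assumes t: "0 \<le> t" and b: "continuous_on {0..t} b"
    and p: "p > 0" and lam: "lam > 0"
    and mono: "mono_on {0..} x" and xinf: "(x \<longlongrightarrow> value_at_infinity x) at_top"
    and lim: "((\<lambda>a. a powr p * (value_at_infinity x - x a)) \<longlongrightarrow> 0) at_top"
  defines "w \<equiv> \<lambda>a. W_path p lam \<sigma> \<kappa> x b a t" and "winf \<equiv> W_infinity_path \<sigma> \<kappa> x b t"
  shows "mono_on {0<..} w" "\<forall>a>0. w a \<le> winf"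
    "((\<lambda>a. a powr p * (winf - w a)) \<longlongrightarrow>
        lam * time_since_zero (W_infinity_path \<sigma> \<kappa> x b) t) at_top"
proof -
  have x_le: "x a \<le> value_at_infinity x" if "a > 0" for a
  proof (rule tendsto_lowerbound[OF xinf])
    show "\<forall>\<^sub>F c in at_top. x a \<le> x c"
      using eventually_ge_at_top[of a] by eventually_elim (use that in \<open>auto intro: mono_onD[OF mono]\<close>)
  qed simp
  have X: "continuous_on {0..t} (X_path p lam \<sigma> \<kappa> x b a)" if "a > 0" for a
    using b that by (auto simp: X_path_def intro!: continuous_intros)
  have Xinf: "continuous_on {0..t} (X_infinity_path \<sigma> \<kappa> x b)"
    using b unfolding X_infinity_path_def by (intro continuous_intros)
  have X_eq: "X_path p lam \<sigma> \<kappa> x b a =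
      (\<lambda>s. X_infinity_path \<sigma> \<kappa> x b s - (value_at_infinity x - x a) - lam * a powr - p * s)"
    if "a > 0" for a
    using that by (auto simp: X_path_def X_infinity_path_def fun_eq_iff algebra_simps)
  show "mono_on {0<..} w"
  proof (rule mono_onI)
    fix a c :: real assume ac: "a \<in> {0<..}" "c \<in> {0<..}" "a \<le> c"
    then have "lam * c powr - p \<le> lam * a powr - p"
      using p lam by (intro mult_left_mono powr_mono2') auto
    then have slope: "lam * c powr - p * s \<le> lam * a powr - p * s"
      "(lam * a powr - p - lam * c powr - p) * s \<le> (lam * a powr - p - lam * c powr - p) * t"
      if "s \<in> {0..t}" for s
      using that by (auto intro!: mult_left_mono mult_right_mono)
    have "x a \<le> x c" using ac by (auto intro: mono_onD[OF mono])
    then show "w a \<le> w c"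
      unfolding w_def W_path_def using ac t slope[of t] slope(2)
      by (intro skorohod_map_mono X) (auto simp: X_path_def algebra_simps)
  qed
  show "\<forall>a>0. w a \<le> winf"
  proof (intro allI impI)
    fix a :: real assume a: "a > 0"
    have "0 \<le> lam * a powr - p * t"
      "\<And>s. s \<in> {0..t} \<Longrightarrow> lam * a powr - p * s \<le> lam * a powr - p * t"
      using lam t by (auto intro!: mult_left_mono)
    then show "w a \<le> winf"
      unfolding w_def winf_def W_path_def W_infinity_path_def using a x_le[OF a] t
      by (intro skorohod_map_mono X Xinf) (auto simp: X_eq)
  qed
  have "((\<lambda>a. (skorohod_map (X_infinity_path \<sigma> \<kappa> x b) t -
      skorohod_map (\<lambda>s. X_infinity_path \<sigma> \<kappa> x b s - (value_at_infinity x - x a) - lam * a powr - p * s) t) /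
      (lam * a powr - p)) \<longlongrightarrow> time_since_zero (skorohod_map (X_infinity_path \<sigma> \<kappa> x b)) t) at_top"
  proof (rule tendsto_skorohod_map_perturbation[OF t Xinf])
    show "((\<lambda>a. lam * a powr - p) \<longlongrightarrow> 0) at_top"
      using p by (intro tendsto_mult_right_zero tendsto_neg_powr filterlim_ident) auto
    show "\<forall>\<^sub>F a in at_top. 0 < lam * a powr - p"
      using eventually_gt_at_top[of 0] by eventually_elim (use lam in auto)
    show "\<forall>\<^sub>F a in at_top. 0 \<le> value_at_infinity x - x a"
      using eventually_gt_at_top[of 0] by eventually_elim (use x_le in auto)
    have "((\<lambda>a. a powr p * (value_at_infinity x - x a) / lam) \<longlongrightarrow> 0 / lam) at_top"
      using lam by (intro tendsto_divide lim) auto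
    then show "((\<lambda>a. (value_at_infinity x - x a) / (lam * a powr - p)) \<longlongrightarrow> 0) at_top"
      by (rule Lim_transform_eventually[THEN tendsto_eq_rhs])
        (auto simp: powr_minus field_simps)
  qed
  from tendsto_mult_left[OF this, of lam]
  show "((\<lambda>a. a powr p * (winf - w a)) \<longlongrightarrow>
        lam * time_since_zero (W_infinity_path \<sigma> \<kappa> x b) t) at_top"
    unfolding W_infinity_path_def
  proof (rule Lim_transform_eventually)
    show "\<forall>\<^sub>F a in at_top. lam * ((skorohod_map (X_infinity_path \<sigma> \<kappa> x b) t -
      skorohod_map (\<lambda>s. X_infinity_path \<sigma> \<kappa> x b s - (value_at_infinity x - x a) - lam * a powr - p * s) t) /
      (lam * a powr - p)) = a powr p * (winf - w a)"
      using eventually_gt_at_top[of 0]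
      by eventually_elim
        (use lam in \<open>simp add: w_def winf_def W_path_def W_infinity_path_def X_eq powr_minus field_simps\<close>)
  qed
qed

section \<open>Assembly on almost every sample path\<close>

theorem theorem4:
  fixes M :: "'a measure" and N :: "'b measure"
    and v :: "'b \<Rightarrow> real" and Fbar :: "real \<Rightarrow> real"
    and p lam \<sigma>\<^sub>A \<sigma> \<kappa> \<eta> \<alpha> :: real
    and \<xi> B :: "real \<Rightarrow> 'a \<Rightarrow> real"
    and Z :: "real \<Rightarrow> 'a \<Rightarrow> real measure"
    and \<xi>inf :: "'a \<Rightarrow> real" and W :: "real \<Rightarrow> real \<Rightarrow> 'a \<Rightarrow> real" and W' :: "real \<Rightarrow> 'a \<Rightarrow> real"
  assumes "p > 1"
    \<comment> \<open>processing time\<close>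
    and "prob_space N" and "v \<in> borel_measurable N" and "AE \<omega> in N. v \<omega> > 0"
    and "continuous_on UNIV (cdf (distr N borel v))" and "cdf (distr N borel v) 0 = 0"
    and Fbar_def: "Fbar = (\<lambda>x. 1 - cdf (distr N borel v) x)"
    and "\<And>t. t > 0 \<Longrightarrow> Fbar t > 0"
    and "\<And>t. t > 0 \<Longrightarrow> ((\<lambda>x. Fbar (t * x) / Fbar x) \<longlongrightarrow> t powr (- (p + 1))) at_top"
    \<comment> \<open>constants\<close>
    and "lam = 1 / prob_space.expectation N v"
    and "\<sigma>\<^sub>A > 0" and "\<sigma> > 0"
    and "\<sigma>\<^sup>2 = lam * prob_space.variance N v + lam * \<sigma>\<^sub>A\<^sup>2"
    \<comment> \<open>limiting initial workload\<close>
    and "prob_space M"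
    and "\<And>a. a \<ge> 0 \<Longrightarrow> \<xi> a \<in> borel_measurable M"
    and "\<And>a \<omega>. a \<ge> 0 \<Longrightarrow> \<omega> \<in> space M \<Longrightarrow> \<xi> a \<omega> \<ge> 0"
    and "\<And>\<omega>. \<omega> \<in> space M \<Longrightarrow> continuous_on {0..} (\<lambda>a. \<xi> a \<omega>)"
    and "\<And>\<omega>. \<omega> \<in> space M \<Longrightarrow> mono_on {0..} (\<lambda>a. \<xi> a \<omega>)"
    and "\<And>\<omega>. \<omega> \<in> space M \<Longrightarrow> \<xi> 0 \<omega> = 0"
    and \<xi>inf_def: "\<xi>inf = (\<lambda>\<omega>. value_at_infinity (\<lambda>a. \<xi> a \<omega>))"
    and "AE \<omega> in M. \<exists>l. ((\<lambda>a. \<xi> a \<omega>) \<longlongrightarrow> l) at_top" and "integrable M \<xi>inf"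
    and "0 < \<eta>" and "\<eta> < p - 1"
    and "(SUP a\<in>{0<..}. ereal (a powr (- (p - \<eta>)) * prob_space.expectation M (\<xi> a))) < \<infinity>"
    and "0 < \<alpha>" and "\<alpha> \<le> p"
    and "Limsup at_top
           (\<lambda>a. ereal (a powr \<alpha> * prob_space.expectation M (\<lambda>\<omega>. \<xi>inf \<omega> - \<xi> a \<omega>))) < \<infinity>"
    \<comment> \<open>Brownian motion and workloads\<close>
    and "standard_brownian_motion M B" and "indep_processes M \<xi> B"
    and W_def: "W = (\<lambda>a t \<omega>. W_path p lam \<sigma> \<kappa> (\<lambda>x. \<xi> x \<omega>) (\<lambda>s. B s \<omega>) a t)"
    and W'_def: "W' = (\<lambda>t \<omega>.
           time_since_zero (W_infinity_path \<sigma> \<kappa> (\<lambda>x. \<xi> x \<omega>) (\<lambda>s. B s \<omega>)) t)"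
    \<comment> \<open>limiting measure-valued process\<close>
    and "\<And>t. t \<ge> 0 \<Longrightarrow> AE \<omega> in M. is_limit_measure (\<lambda>x. W x t \<omega>) (Z t \<omega>)"
    \<comment> \<open>additional assumption\<close>
    and "AE \<omega> in M. ((\<lambda>x. x powr p * (\<xi>inf \<omega> - \<xi> x \<omega>)) \<longlongrightarrow> 0) at_top"
  shows "\<forall>t\<ge>0.
      (AE \<omega> in M.
         (\<forall>a>0. integrable (Z t \<omega>) (\<lambda>x. x * indicator {a..} x)) \<and>
         ((\<lambda>a. a powr p / lam * (\<integral>x. x * indicator {a..} x \<partial>Z t \<omega>)) \<longlongrightarrow> W' t \<omega>) at_top) \<and>
      (AE \<omega> in M.
         ((\<lambda>a. (p + 1) * a powr (p + 1) / (p * lam) * measure (Z t \<omega>) {a..}) \<longlongrightarrow> W' t \<omega>) at_top) \<and>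
      (AE \<omega> in M. W' t \<omega> \<noteq> 0 \<longrightarrow>
         ((\<lambda>a. (\<integral>x. x * indicator {a..} x \<partial>Z t \<omega>) / (cond_exp_ge N v a * measure (Z t \<omega>) {a..}))
            \<longlongrightarrow> 1) at_top)"
proof -
  have p: "p > 1" by fact
  have p0: "p > 0" using p by simp
  have v: "prob_space.expectation N v > 0"
    "((\<lambda>a. cond_exp_ge N v a / a) \<longlongrightarrow> (p + 1) / p) at_top"
    by (rule regularly_varying_moments[OF assms(2-5) Fbar_def assms(8,9) p]; assumption)+
  have lam: "lam > 0" using v(1) assms(10) by simp
  have B: "AE \<omega> in M. continuous_on {0..} (\<lambda>t. B t \<omega>)"
    using assms(29) by (simp add: standard_brownian_motion_def)
  \<comment> \<open>Both limits are obtained outside one null set, so that they can be divided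
    afterwards. This set depends on \<open>t\<close> only through the hypothesis on
    \<open>Z t\<close>.\<close>
  have *: "AE \<omega> in M.
      (\<forall>a>0. integrable (Z t \<omega>) (\<lambda>x. x * indicator {a..} x)) \<and>
      ((\<lambda>a. a powr p / lam * (\<integral>x. x * indicator {a..} x \<partial>Z t \<omega>)) \<longlongrightarrow> W' t \<omega>) at_top \<and>
      ((\<lambda>a. (p + 1) * a powr (p + 1) / (p * lam) * measure (Z t \<omega>) {a..}) \<longlongrightarrow> W' t \<omega>) at_top"
    if t: "t \<ge> 0" for t
    using B assms(21) assms(33)[OF t] assms(34) AE_space
  proof eventually_elim
    case (elim \<omega>)
    have b: "continuous_on {0..t} (\<lambda>s. B s \<omega>)"
      using elim(1) by (rule continuous_on_subset) auto
    have xinf: "((\<lambda>a. \<xi> a \<omega>) \<longlongrightarrow> value_at_infinity (\<lambda>a. \<xi> a \<omega>)) at_top"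
      using elim(2) tendsto_Lim[OF trivial_limit_at_top_linorder] by (auto simp: value_at_infinity_def)
    note path = tendsto_W_path[OF t b p0 lam assms(18)[OF elim(5)] xinf
        elim(4)[unfolded \<xi>inf_def], where \<sigma> = \<sigma> and \<kappa> = \<kappa>]
    note tail = limit_measure_tail[OF elim(3)[unfolded W_def] path(1,2) p0 path(3)]
    have "((\<lambda>a. a powr p * (\<integral>x. x * indicator {a..} x \<partial>Z t \<omega>) / lam) \<longlongrightarrow> lam * W' t \<omega> / lam) at_top"
      unfolding W'_def using lam by (intro tendsto_divide tail(3)) auto
    moreover have "((\<lambda>a. (p + 1) / (p * lam) * (a powr (p + 1) * measure (Z t \<omega>) {a..})) \<longlongrightarrow>
        (p + 1) / (p * lam) * (lam * W' t \<omega> * p / (p + 1))) at_top"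
      unfolding W'_def by (intro tendsto_mult_left tail(1))
    moreover have "(p + 1) / (p * lam) * (lam * W' t \<omega> * p / (p + 1)) = W' t \<omega>"
      using p lam by simp
    ultimately show ?case
      using tail(2) lam by (simp add: algebra_simps)
  qed
  \<comment> \<open>Scaled by \<open>a powr p / lam\<close>, numerator and denominator both tend to
    \<open>l\<close>: the factor \<open>p / (p + 1)\<close> offsets the limit of
    \<open>cond_exp_ge N v a / a\<close>. Division needs \<open>l \<noteq> 0\<close>.\<close>
  have ratio: "((\<lambda>a. (\<integral>x. x * indicator {a..} x \<partial>mu) / (cond_exp_ge N v a * measure mu {a..})) \<longlongrightarrow> 1) at_top"
    if I: "((\<lambda>a. a powr p / lam * (\<integral>x. x * indicator {a..} x \<partial>mu)) \<longlongrightarrow> l) at_top"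
      and G: "((\<lambda>a. (p + 1) * a powr (p + 1) / (p * lam) * measure mu {a..}) \<longlongrightarrow> l) at_top"
      and l: "l \<noteq> 0" for mu l
  proof -
    have "((\<lambda>a. a powr p / lam * (\<integral>x. x * indicator {a..} x \<partial>mu) /
        (cond_exp_ge N v a / a * (p / (p + 1)) *
          ((p + 1) * a powr (p + 1) / (p * lam) * measure mu {a..}))) \<longlongrightarrow>
        l / ((p + 1) / p * (p / (p + 1)) * l)) at_top"
      using l p by (intro tendsto_divide tendsto_mult tendsto_const I G v(2)) auto
    then show ?thesis
    proof (rule Lim_transform_eventually[THEN tendsto_eq_rhs])
      show "\<forall>\<^sub>F a in at_top. a powr p / lam * (\<integral>x. x * indicator {a..} x \<partial>mu) /
          (cond_exp_ge N v a / a * (p / (p + 1)) *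
            ((p + 1) * a powr (p + 1) / (p * lam) * measure mu {a..})) =
          (\<integral>x. x * indicator {a..} x \<partial>mu) / (cond_exp_ge N v a * measure mu {a..})"
        using eventually_gt_at_top[of 0]
      proof eventually_elim
        case (elim a)
        \<comment> \<open>Only the nonzero scale \<open>c\<close> is cancelled, so the identity
          holds even where the tail mass vanishes.\<close>
        define c where "c = a powr p / lam"
        have c: "c \<noteq> 0" using elim lam by (simp add: c_def)
        have "cond_exp_ge N v a / a * (p / (p + 1)) *
            ((p + 1) * a powr (p + 1) / (p * lam) * measure mu {a..}) =
            c * (cond_exp_ge N v a * measure mu {a..})"
          using elim p lam by (simp add: c_def powr_add)
        then show ?case unfolding c_def[symmetric] using c by simp
      qed
      show "l / ((p + 1) / p * (p / (p + 1)) * l) = 1" using l p by simp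
    qed
  qed
  show ?thesis
  proof (intro allI impI conjI)
    fix t :: real assume t: "t \<ge> 0"
    show "AE \<omega> in M. (\<forall>a>0. integrable (Z t \<omega>) (\<lambda>x. x * indicator {a..} x)) \<and>
        ((\<lambda>a. a powr p / lam * (\<integral>x. x * indicator {a..} x \<partial>Z t \<omega>)) \<longlongrightarrow> W' t \<omega>) at_top"
      using *[OF t] by eventually_elim simp
    show "AE \<omega> in M.
        ((\<lambda>a. (p + 1) * a powr (p + 1) / (p * lam) * measure (Z t \<omega>) {a..}) \<longlongrightarrow> W' t \<omega>) at_top"
      using *[OF t] by eventually_elim simp
    show "AE \<omega> in M. W' t \<omega> \<noteq> 0 \<longrightarrow>
        ((\<lambda>a. (\<integral>x. x * indicator {a..} x \<partial>Z t \<omega>) / (cond_exp_ge N v a * measure (Z t \<omega>) {a..}))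
          \<longlongrightarrow> 1) at_top"
      using *[OF t] by eventually_elim (use ratio in blast)
  qed
qed

end
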